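(* For all constants $c$ and all $d>0$, any (possibly randomized) non-adaptive algorithm for PARTITION with query complexity $dn$ necessarily has expected $c$-weighted error $\Omega((n/d)^{c+1})$ in the noiseless model, $\Omega((n/(d\gamma))^{c+1})$ in the erasure model, and $\Omega((n/(d\gamma^2))^{c+1})$ in the noisy model.
   Context: Setting. The input is a set of $n$ elements with an unknown total order, presented in uniformly random order (the elements are a priori indistinguishable). For $i\in\{1,\dots,n\}$ the $i$-th smallest element is denoted $i$. PARTITION (with cutoff the median, $k=n/2$): output a partition of the elements into a set $A$ (accepted, meant to be the elements above the median) and a set $R$ (rejected, meant to be the elements below the median). For a constant $c\ge 0$, the $c$-weighted error of $A\sqcup R$ is $\sum_{i>n/2} I(i\in R)\,|i-n/2|^c+\sum_{i<n/2} I(i\in A)\,|i-n/2|^c$, where $I$ is the indicator function (so $c=0$ counts mistakes). Algorithms access the order only through pairwise comparison queries; the same pair may be queried several times. Query complexity is the total number of comparisons. Non-adaptive means round complexity $1$: all queries are chosen before any answer is seen. Noiseless model: every comparison returns the correct answer. Erasure model with parameter $\gamma$: each comparison independently returns the correct answer with probability $\gamma$ and the symbol $\bot$ with probability $1-\gamma$. Noisy model with parameter $\gamma$: each comparison independently returns the correct answer with probability $1/2+\gamma/2$ and the incorrect answer with probability $1/2-\gamma/2$. Asymptotics are as $n\to\infty$; hidden constants may depend on $c$. Expectations are over the random input order, the comparison outcomes and the algorithm's randomness.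
   Formalization: The hidden constants depend on c and on an arbitrary positive lower bound for d, dγ, dγ² respectively (for very small values the bound would exceed the maximal error), and "n→∞" means that n/d, n/(dγ), n/(dγ²) respectively exceeds such a constant. *)

theory Defs
  imports "HOL-Probability.Probability" "HOL-Combinatorics.Permutations"
begin

text \<open>
  The \<open>n\<close> elements carry labels \<open>{1..n}\<close>, and an input is a permutation \<open>\<sigma>\<close> of \<open>{1..n}\<close>: \<open>\<sigma> x\<close> is
  the rank of the element labelled \<open>x\<close>. An oracle maps the correct answer of a comparison to the
  distribution of the answer that is returned.
\<close>

definition noiseless :: "bool \<Rightarrow> bool pmf" where
  "noiseless b = return_pmf b"

definition erasure :: "real \<Rightarrow> bool \<Rightarrow> bool option pmf" where
  "erasure \<gamma> b = map_pmf (\<lambda>ok. if ok then Some b else None) (bernoulli_pmf \<gamma>)"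

definition noisy :: "real \<Rightarrow> bool \<Rightarrow> bool pmf" where
  "noisy \<gamma> b = map_pmf (\<lambda>ok. if ok then b else \<not> b) (bernoulli_pmf (1/2 + \<gamma>/2))"

text \<open>
  A deterministic non-adaptive algorithm fixes its whole list of queries in advance and then maps the
  list of answers to the set of accepted labels; all other labels are rejected. A randomized
  algorithm is a distribution over deterministic ones. Discrete distributions lose no generality,
  since for a given \<open>n\<close> and a given bound on the number of queries, only finitely many behaviours
  of deterministic algorithms exist.
\<close>

record 'ans nonadaptive =
  queries :: "(nat \<times> nat) list"
  accept :: "'ans list \<Rightarrow> nat set"

definition nonadaptive_algorithm :: "nat \<Rightarrow> real \<Rightarrow> 'ans nonadaptive pmf \<Rightarrow> bool" where
  "nonadaptive_algorithm n q alg \<longleftrightarrow>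
     (\<forall>s\<in>set_pmf alg. real (length (queries s)) \<le> q \<and>
        (\<forall>(x, y)\<in>set (queries s). x \<in> {1..n} \<and> y \<in> {1..n} \<and> x \<noteq> y))"

primrec answers ::
  "(bool \<Rightarrow> 'ans pmf) \<Rightarrow> (nat \<Rightarrow> nat) \<Rightarrow> (nat \<times> nat) list \<Rightarrow> 'ans list pmf" where
  "answers orc \<sigma> [] = return_pmf []"
| "answers orc \<sigma> (q # qs) = do {
     a \<leftarrow> orc (\<sigma> (fst q) < \<sigma> (snd q));
     as \<leftarrow> answers orc \<sigma> qs;
     return_pmf (a # as)
   }"

text \<open>Here \<open>A\<close> and \<open>R\<close> are the sets of ranks of the accepted and of the rejected elements.\<close>

definition weighted_error :: "real \<Rightarrow> nat \<Rightarrow> nat set \<Rightarrow> nat set \<Rightarrow> real" where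
  "weighted_error c n A R =
     (\<Sum>i\<in>{i\<in>{1..n}. real i > real n / 2}. indicator R i * \<bar>real i - real n / 2\<bar> powr c) +
     (\<Sum>i\<in>{i\<in>{1..n}. real i < real n / 2}. indicator A i * \<bar>real i - real n / 2\<bar> powr c)"

definition error_distribution ::
  "(bool \<Rightarrow> 'ans pmf) \<Rightarrow> real \<Rightarrow> nat \<Rightarrow> 'ans nonadaptive pmf \<Rightarrow> real pmf" where
  "error_distribution orc c n alg = do {
     \<sigma> \<leftarrow> pmf_of_set {\<sigma>. \<sigma> permutes {1..n}};
     s \<leftarrow> alg;
     as \<leftarrow> answers orc \<sigma> (queries s);
     return_pmf (weighted_error c n (\<sigma> ` ({1..n} \<inter> accept s as)) (\<sigma> ` ({1..n} - accept s as)))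
   }"

definition expected_error ::
  "(bool \<Rightarrow> 'ans pmf) \<Rightarrow> real \<Rightarrow> nat \<Rightarrow> 'ans nonadaptive pmf \<Rightarrow> real" where
  "expected_error orc c n alg = measure_pmf.expectation (error_distribution orc c n alg) (\<lambda>e. e)"

end

theory Submission imports Defs begin

text \<open>
  Take a label \<open>x\<close> whose rank lies slightly below the median, and move it by \<open>3w\<close> ranks to slightly above
  the median, keeping the relative order of all other elements. Only comparisons between \<open>x\<close> and an
  element whose rank is passed by this move change their correct answer; for a random input and \<open>dn\<close>
  queries, the expected number of these, averaged over \<open>x\<close>, is \<open>O(dw/n)\<close>. Measure how
  informative an oracle is by \<open>\<beta>\<close>, where the Bhattacharyya affinity of its two answer
  distributions is at least \<open>1 - \<beta>\<close>: \<open>\<beta>\<close> is \<open>1\<close>, \<open>\<gamma>\<close>, \<open>\<gamma>\<^sup>2\<close> in the three models. Affinity is multiplicative over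
  independent answers, so for \<open>w\<close> a small multiple of \<open>n / (d\<beta>)\<close> the two inputs are
  hard to distinguish. About \<open>w\<close> labels have a rank in each window, and each errs with constant
  probability at a cost of at least \<open>w\<^sup>c\<close>, which gives an expected error of order \<open>w\<^bsup>c+1\<^esup>\<close>.
\<close>

section \<open>Affinity and the error of distinguishing two distributions\<close>

definition affinity :: "'a set \<Rightarrow> 'a pmf \<Rightarrow> 'a pmf \<Rightarrow> real" where
  "affinity A P Q = (\<Sum>a\<in>A. sqrt (pmf P a * pmf Q a))"

lemma affinity_nonneg: "0 \<le> affinity A P Q"
  unfolding affinity_def by (intro sum_nonneg) simp

lemma affinity_commute: "affinity A P Q = affinity A Q P"
  unfolding affinity_def by (simp add: mult.commute)

lemma affinity_self: "affinity (UNIV :: 'a::finite set) P P = 1"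
  by (simp add: affinity_def sum_pmf_eq_1)

lemma prob_eq_sum:
  assumes "finite A" "set_pmf P \<subseteq> A"
  shows "measure_pmf.prob P E = (\<Sum>a\<in>A. indicator E a * pmf P a)"
  using integral_measure_pmf_real[of A P "indicator E"] assms by auto

text \<open>
  The affinity enters linearly, so that after the Bernoulli inequality the bound is linear in
  the number of changed answers and can be averaged term by term over labels and inputs.
\<close>

lemma affinity_le_testing_error:
  assumes "finite A" "set_pmf P \<subseteq> A" "set_pmf Q \<subseteq> A"
  shows "affinity A P Q - 1/2 \<le> measure_pmf.prob P E + measure_pmf.prob Q (- E)"
proof -
  \<comment> \<open>Weighted AM-GM already gives \<open>x + y / 4\<close>. The surplus
    \<open>x / 4\<close> makes the remainder symmetric in \<open>x\<close> and \<open>y\<close>, so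
    it sums to \<open>1/2\<close> whatever \<open>E\<close> is.\<close>
  have amgm: "sqrt (x * y) \<le> x + (x / 4 + y / 4)" if "0 \<le> x" "0 \<le> y" for x y :: real
  proof -
    have "sqrt (x * y) \<le> x + y / 4"
    proof (rule real_le_lsqrt)
      have "0 \<le> (x - y / 4)\<^sup>2" by simp
      then show "x * y \<le> (x + y / 4)\<^sup>2" by (simp add: power2_eq_square algebra_simps)
    qed (use that in auto)
    then show ?thesis using that by linarith
  qed
  have "affinity A P Q \<le> (\<Sum>a\<in>A. (indicator E a * pmf P a + indicator (- E) a * pmf Q a)
      + (pmf P a / 4 + pmf Q a / 4))"
    unfolding affinity_def
  proof (rule sum_mono)
    fix a
    show "sqrt (pmf P a * pmf Q a) \<le> (indicator E a * pmf P a + indicator (- E) a * pmf Q a)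
      + (pmf P a / 4 + pmf Q a / 4)"
    proof (cases "a \<in> E")
      case True
      then show ?thesis using amgm[of "pmf P a" "pmf Q a"] by simp
    next
      case False
      then show ?thesis using amgm[of "pmf Q a" "pmf P a"] by (simp add: mult.commute)
    qed
  qed
  also have "\<dots> = measure_pmf.prob P E + measure_pmf.prob Q (- E) + (1 / 4 + 1 / 4)"
    using assms
    by (simp add: sum.distrib prob_eq_sum[of A] sum_pmf_eq_1 flip: sum_divide_distrib)
  finally show ?thesis by simp
qed

section \<open>Distribution of the answer list and its affinity\<close>

lemma finite_lists_of_length: "finite {as :: 'ans::finite list. length as = k}"
  using finite_lists_length_eq[of "UNIV :: 'ans set" k] by simp

lemma sum_lists_length_Suc:
  "(\<Sum>as\<in>{as :: 'ans::finite list. length as = Suc k}. f as) =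
     (\<Sum>a\<in>UNIV. \<Sum>as\<in>{as. length as = k}. f (a # as))"
proof -
  have "(\<Sum>as\<in>{as :: 'ans list. length as = Suc k}. f as) =
      (\<Sum>(a, as)\<in>UNIV \<times> {as. length as = k}. f (a # as))"
    by (rule sum.reindex_bij_witness[of _ "\<lambda>(a, as). a # as" "\<lambda>as. (hd as, tl as)"])
       (auto simp: length_Suc_conv)
  then show ?thesis by (simp add: sum.cartesian_product)
qed

lemma answers_Cons_eq_map:
  "answers orc \<sigma> (q # qs) =
     map_pmf (\<lambda>(a, as). a # as) (pair_pmf (orc (\<sigma> (fst q) < \<sigma> (snd q))) (answers orc \<sigma> qs))"
  by (simp add: pair_pmf_def map_bind_pmf)

lemma pmf_answers_Cons:
  "pmf (answers orc \<sigma> (q # qs)) (a # as) =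
     pmf (orc (\<sigma> (fst q) < \<sigma> (snd q))) a * pmf (answers orc \<sigma> qs) as"
proof -
  have "inj (\<lambda>(a :: 'a, as). a # as)" by (auto simp: inj_def)
  then show ?thesis
    unfolding answers_Cons_eq_map
    using pmf_map_inj'[of "\<lambda>(a, as). a # as" _ "(a, as)"] by (simp add: pmf_pair)
qed

lemma set_pmf_answers: "set_pmf (answers orc \<sigma> qs) \<subseteq> {as. length as = length qs}"
  by (induction qs) auto

lemma finite_set_pmf_answers:
  "finite (set_pmf (answers (orc :: bool \<Rightarrow> 'ans::finite pmf) \<sigma> qs))"
  by (rule finite_subset[OF set_pmf_answers finite_lists_of_length])

text \<open>A repeated query counts each time, because each repetition is answered
  independently.\<close>

definition disagreements :: "(nat \<Rightarrow> nat) \<Rightarrow> (nat \<Rightarrow> nat) \<Rightarrow> (nat \<times> nat) list \<Rightarrow> nat" where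
  "disagreements \<sigma> \<tau> qs =
     (\<Sum>q\<leftarrow>qs. of_bool ((\<sigma> (fst q) < \<sigma> (snd q)) \<noteq> (\<tau> (fst q) < \<tau> (snd q))))"

text \<open>Independence of the answers makes the affinity a product over the queries. A query with
  the same correct answer in both inputs contributes the factor 1, any other at least
  \<open>1 - \<beta>\<close>.\<close>

lemma affinity_answers:
  fixes orc :: "bool \<Rightarrow> 'ans::finite pmf"
  assumes orc: "1 - \<beta> \<le> affinity UNIV (orc True) (orc False)" and \<beta>: "\<beta> \<le> 1"
  shows "(1 - \<beta>) ^ disagreements \<sigma> \<tau> qs \<le>
    affinity {as. length as = length qs} (answers orc \<sigma> qs) (answers orc \<tau> qs)"
proof (induction qs)
  case Nil
  then show ?case by (simp add: affinity_def disagreements_def)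
next
  case (Cons q qs)
  let ?b = "\<sigma> (fst q) < \<sigma> (snd q)" and ?b' = "\<tau> (fst q) < \<tau> (snd q)"
  have "affinity {as. length as = length (q # qs)} (answers orc \<sigma> (q # qs)) (answers orc \<tau> (q # qs))
    = (\<Sum>a\<in>UNIV. \<Sum>as\<in>{as. length as = length qs}.
        sqrt (pmf (orc ?b) a * pmf (orc ?b') a) *
        sqrt (pmf (answers orc \<sigma> qs) as * pmf (answers orc \<tau> qs) as))"
    unfolding affinity_def list.size add_0_right add_Suc_right sum_lists_length_Suc pmf_answers_Cons
    by (simp add: real_sqrt_mult ac_simps)
  also have "\<dots> = affinity UNIV (orc ?b) (orc ?b') *
      affinity {as. length as = length qs} (answers orc \<sigma> qs) (answers orc \<tau> qs)"
    unfolding affinity_def by (simp add: sum_product)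
  also have "(1 - \<beta>) ^ of_bool (?b \<noteq> ?b') * (1 - \<beta>) ^ disagreements \<sigma> \<tau> qs \<le> \<dots>"
  proof (rule mult_mono[OF _ Cons.IH])
    show "(1 - \<beta>) ^ of_bool (?b \<noteq> ?b') \<le> affinity UNIV (orc ?b) (orc ?b')"
      using orc affinity_commute[of UNIV "orc True" "orc False"]
      by (cases ?b; cases ?b') (auto simp: affinity_self)
  qed (use \<beta> affinity_nonneg in auto)
  also have "(1 - \<beta>) ^ of_bool (?b \<noteq> ?b') * (1 - \<beta>) ^ disagreements \<sigma> \<tau> qs =
      (1 - \<beta>) ^ disagreements \<sigma> \<tau> (q # qs)"
    by (simp add: disagreements_def power_add)
  finally show ?case .
qed

text \<open>Bernoulli's inequality replaces the power \<open>(1 - \<beta>) ^ k\<close> by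
  \<open>1 - \<beta> * k\<close>. With \<open>E\<close> the event that a label is accepted, the
  right-hand side adds its error probability when it should be rejected to that when it should be
  accepted.\<close>

lemma testing_error_answers:
  fixes orc :: "bool \<Rightarrow> 'ans::finite pmf"
  assumes "1 - \<beta> \<le> affinity UNIV (orc True) (orc False)" and "\<beta> \<le> 1"
  shows "1/2 - \<beta> * real (disagreements \<sigma> \<tau> qs) \<le>
    measure_pmf.prob (answers orc \<sigma> qs) E + measure_pmf.prob (answers orc \<tau> qs) (- E)"
  using affinity_answers[OF assms, of \<sigma> \<tau> qs] Bernoulli_inequality[of "- \<beta>" "disagreements \<sigma> \<tau> qs"]
    affinity_le_testing_error[OF finite_lists_of_length set_pmf_answers[of orc \<sigma> qs] set_pmf_answers[of orc \<tau> qs], of E]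
    assms(2)
  by (simp add: mult.commute)

section \<open>Affinities of the three oracles\<close>

lemma affinity_noiseless: "affinity UNIV (noiseless True) (noiseless False) = 0"
  by (simp add: affinity_def noiseless_def UNIV_bool)

text \<open>The two answer distributions share only the erased answer \<open>None\<close>, of mass
  \<open>1 - \<gamma>\<close> under both.\<close>

lemma affinity_erasure:
  assumes "0 \<le> \<gamma>" "\<gamma> \<le> 1"
  shows "affinity UNIV (erasure \<gamma> True) (erasure \<gamma> False) = 1 - \<gamma>"
proof -
  have e: "erasure \<gamma> b = bernoulli_pmf \<gamma> \<bind> (\<lambda>ok. return_pmf (if ok then Some b else None))" for b
    by (simp add: erasure_def map_pmf_def)
  show ?thesis using assms
    by (simp add: affinity_def UNIV_option_conv UNIV_bool e pmf_bind integral_bernoulli_pmf)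
qed

text \<open>The exact value is the square root of \<open>1 - \<gamma>\<^sup>2\<close>, which
  dominates \<open>1 - \<gamma>\<^sup>2\<close> because the latter lies in the unit
  interval.\<close>

lemma affinity_noisy:
  assumes "0 \<le> \<gamma>" "\<gamma> \<le> 1"
  shows "1 - \<gamma>\<^sup>2 \<le> affinity UNIV (noisy \<gamma> True) (noisy \<gamma> False)"
proof -
  have e: "noisy \<gamma> b = bernoulli_pmf (1/2 + \<gamma>/2) \<bind> (\<lambda>ok. return_pmf (if ok then b else \<not> b))" for b
    by (simp add: noisy_def map_pmf_def)
  have g: "\<gamma>\<^sup>2 \<le> 1" using assms by (simp add: power_le_one)
  define r where "r = sqrt ((1/2 + \<gamma>/2) * (1/2 - \<gamma>/2))"
  have "(1 - \<gamma>\<^sup>2) / 2 \<le> r"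
    unfolding r_def
  proof (rule real_le_rsqrt)
    have "(1 - \<gamma>\<^sup>2)\<^sup>2 \<le> 1 - \<gamma>\<^sup>2"
      using power_decreasing[of 1 2 "1 - \<gamma>\<^sup>2"] g by simp
    then show "((1 - \<gamma>\<^sup>2) / 2)\<^sup>2 \<le> (1/2 + \<gamma>/2) * (1/2 - \<gamma>/2)"
      by (simp add: power2_eq_square field_simps)
  qed
  moreover have "affinity UNIV (noisy \<gamma> True) (noisy \<gamma> False) = 2 * r"
    using assms
    by (simp add: r_def affinity_def UNIV_bool e pmf_bind integral_bernoulli_pmf mult.commute)
  ultimately show ?thesis by (simp add: field_simps)
qed

section \<open>Counting permutations with prescribed values\<close>

lemma inj_transpose_comp: "inj ((\<circ>) (Transposition.transpose a b))"
  by (rule inj_on_inverseI[where g = "(\<circ>) (Transposition.transpose a b)"]) (simp add: o_assoc)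

lemma transpose_comp_permutes_remove:
  assumes "a \<in> S" "p permutes S"
  shows "Transposition.transpose a (p a) \<circ> p permutes S - {a}"
proof (rule permutes_superset)
  show "Transposition.transpose a (p a) \<circ> p permutes S"
    using assms by (intro permutes_compose permutes_swap_id) (auto simp: permutes_in_image)
qed auto

text \<open>Composing with the transposition of \<open>a\<close> and \<open>b\<close> makes
  \<open>a\<close> a fixed point, which injects these permutations into those of
  \<open>S - {a}\<close>.\<close>

lemma card_permutes_value_le:
  assumes "finite S" "a \<in> S"
  shows "card {p. p permutes S \<and> p a = b} \<le> fact (card S - 1)"
proof -
  have "card {p. p permutes S \<and> p a = b} \<le> card {p. p permutes S - {a}}"
    using assms
    by (intro card_inj_on_le[OF inj_on_subset[OF inj_transpose_comp[of a b]]])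
       (auto simp: finite_permutations intro: transpose_comp_permutes_remove)
  then show ?thesis using card_permutations[of "S - {a}" "card S - 1"] assms by simp
qed

text \<open>The same composition removes \<open>a\<close> and turns the condition on
  \<open>a'\<close> into a prescribed value for a permutation of \<open>S - {a}\<close>, to which
  the bound for one value applies.\<close>

lemma card_permutes_two_values_le:
  assumes "finite S" "a \<in> S" "a' \<in> S" "a \<noteq> a'"
  shows "card {p. p permutes S \<and> p a = b \<and> p a' = b'} \<le> fact (card S - 2)"
proof -
  have "card {p. p permutes S \<and> p a = b \<and> p a' = b'} \<le>
      card {p. p permutes S - {a} \<and> p a' = Transposition.transpose a b b'}"
    using assms
    by (intro card_inj_on_le[OF inj_on_subset[OF inj_transpose_comp[of a b]]])
       (auto simp: finite_permutations intro: transpose_comp_permutes_remove)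
  also have "\<dots> \<le> fact (card (S - {a}) - 1)"
    using assms by (intro card_permutes_value_le) auto
  finally show ?thesis using assms by (simp add: numeral_2_eq_2)
qed

section \<open>Moving one element and counting the changed answers\<close>

text \<open>It acts on ranks: \<open>move (\<sigma> x) s \<circ> \<sigma>\<close> is the input in
  which the label \<open>x\<close> has risen by \<open>s\<close> ranks past \<open>s\<close> others,
  each of which drops by one.\<close>

definition move :: "nat \<Rightarrow> nat \<Rightarrow> nat \<Rightarrow> nat" where
  "move i s j = (if j = i then i + s else if i < j \<and> j \<le> i + s then j - 1 else j)"

lemma inj_move: "inj (move i s)"
  unfolding inj_def move_def by (auto split: if_splits)

lemma move_permutes:
  assumes "1 \<le> i" "i + s \<le> n"
  shows "move i s permutes {1..n}"
  using assms by (intro inj_imp_permutes inj_on_subset[OF inj_move]) (auto simp: move_def)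

lemma move_less_move_iff:
  assumes "j \<noteq> i" "k \<noteq> i"
  shows "move i s j < move i s k \<longleftrightarrow> j < k"
  using assms by (auto simp: move_def)

lemma move_less_move_self_iff:
  assumes "j \<noteq> i" "j \<notin> {i<..i + s}"
  shows "move i s j < move i s i \<longleftrightarrow> j < i"
   and "move i s i < move i s j \<longleftrightarrow> i < j"
  using assms by (auto simp: move_def)

text \<open>All other ranks keep their order among themselves and, unless passed, relative to
  \<open>x\<close>. So a changed answer needs \<open>x\<close> on one side of the query and a passed
  element on the other; the two summands are the two positions of \<open>x\<close>.\<close>

lemma disagreements_move_le:
  fixes qs :: "(nat \<times> nat) list"
  assumes "\<sigma> permutes {1..n}"
  shows "disagreements \<sigma> (move (\<sigma> x) s \<circ> \<sigma>) qs \<le>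
    (\<Sum>q\<leftarrow>qs. of_bool (fst q = x \<and> \<sigma> (snd q) \<in> {\<sigma> x<..\<sigma> x + s}) +
            of_bool (snd q = x \<and> \<sigma> (fst q) \<in> {\<sigma> x<..\<sigma> x + s}))"
  unfolding disagreements_def
proof (rule sum_list_mono)
  fix q :: "nat \<times> nat"
  obtain u v where q: "q = (u, v)" by fastforce
  have inj: "\<sigma> y = \<sigma> x \<longleftrightarrow> y = x" for y
    using permutes_inj[OF assms] by (auto simp: inj_def)
  show "(of_bool ((\<sigma> (fst q) < \<sigma> (snd q)) \<noteq>
        ((move (\<sigma> x) s \<circ> \<sigma>) (fst q) < (move (\<sigma> x) s \<circ> \<sigma>) (snd q))) :: nat) \<le>
    of_bool (fst q = x \<and> \<sigma> (snd q) \<in> {\<sigma> x<..\<sigma> x + s}) +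
    of_bool (snd q = x \<and> \<sigma> (fst q) \<in> {\<sigma> x<..\<sigma> x + s})"
    unfolding q fst_conv snd_conv o_apply
    using move_less_move_iff[of "\<sigma> u" "\<sigma> x" "\<sigma> v" s]
      move_less_move_self_iff[of "\<sigma> u" "\<sigma> x" s] move_less_move_self_iff[of "\<sigma> v" "\<sigma> x" s] inj[of u] inj[of v]
    by (cases "u = x"; cases "v = x") auto
qed

text \<open>Union bound over the \<open>card L * s\<close> possible pairs of ranks of
  \<open>u\<close> and \<open>v\<close>.\<close>

lemma card_permutes_window_le:
  fixes n s :: nat and L :: "nat set"
  assumes "u \<in> {1..n}" "v \<in> {1..n}" "u \<noteq> v" "finite L"
  shows "card {\<sigma>. \<sigma> permutes {1..n} \<and> \<sigma> u \<in> L \<and> \<sigma> v \<in> {\<sigma> u<..\<sigma> u + s}} \<le> card L * s * fact (n - 2)"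
proof -
  have "{\<sigma>. \<sigma> permutes {1..n} \<and> \<sigma> u \<in> L \<and> \<sigma> v \<in> {\<sigma> u<..\<sigma> u + s}} \<subseteq>
     (\<Union>(i, j) \<in> (SIGMA i:L. {i<..i + s}). {\<sigma>. \<sigma> permutes {1..n} \<and> \<sigma> u = i \<and> \<sigma> v = j})"
    by auto
  moreover have "finite \<dots>"
    using assms(4) by (auto intro: finite_subset[OF _ finite_permutations[of "{1..n}"]])
  ultimately have "card {\<sigma>. \<sigma> permutes {1..n} \<and> \<sigma> u \<in> L \<and> \<sigma> v \<in> {\<sigma> u<..\<sigma> u + s}} \<le>
     card (\<Union>(i, j) \<in> (SIGMA i:L. {i<..i + s}). {\<sigma>. \<sigma> permutes {1..n} \<and> \<sigma> u = i \<and> \<sigma> v = j})"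
    by (rule card_mono[rotated])
  also have "\<dots> \<le> (\<Sum>(i, j) \<in> (SIGMA i:L. {i<..i + s}).
      card {\<sigma>. \<sigma> permutes {1..n} \<and> \<sigma> u = i \<and> \<sigma> v = j})"
    using card_UN_le[of "SIGMA i:L. {i<..i + s}"] assms(4) by (simp add: case_prod_unfold)
  also have "\<dots> \<le> of_nat (card (SIGMA i:L. {i<..i + s})) * fact (n - 2)"
    using card_permutes_two_values_le[of "{1..n}" u v] assms by (intro sum_bounded_above) auto
  also have "card (SIGMA i:L. {i<..i + s}) = card L * s"
    using assms(4) by simp
  finally show ?thesis by simp
qed

text \<open>One label may occur in many queries, but in the sum over \<open>x\<close> each query
  matters only for its own two labels. This is the factor 2, and the bound is linear in the number
  of queries however they are chosen.\<close>

lemma sum_disagreements_move_le: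
  fixes n s :: nat and L :: "nat set" and qs :: "(nat \<times> nat) list"
  assumes "finite L" and qs: "\<forall>(u, v)\<in>set qs. u \<in> {1..n} \<and> v \<in> {1..n} \<and> u \<noteq> v"
  shows "(\<Sum>x\<in>{1..n}. \<Sum>\<sigma> | \<sigma> permutes {1..n} \<and> \<sigma> x \<in> L. disagreements \<sigma> (move (\<sigma> x) s \<circ> \<sigma>) qs)
    \<le> length qs * (2 * card L * s * fact (n - 2))"
proof -
  let ?S = "\<lambda>x. {\<sigma>. \<sigma> permutes {1..n} \<and> \<sigma> x \<in> L}"
  let ?I = "\<lambda>q x \<sigma>. of_bool (fst q = x \<and> \<sigma> (snd q) \<in> {\<sigma> x<..\<sigma> x + s}) +
      of_bool (snd q = x \<and> \<sigma> (fst q) \<in> {\<sigma> x<..\<sigma> x + s}) :: nat"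
  have fin: "finite (?S x)" for x
    by (auto intro: finite_subset[OF _ finite_permutations[of "{1..n}"]])
  have "(\<Sum>x\<in>{1..n}. \<Sum>\<sigma>\<in>?S x. disagreements \<sigma> (move (\<sigma> x) s \<circ> \<sigma>) qs) \<le>
      (\<Sum>x\<in>{1..n}. \<Sum>\<sigma>\<in>?S x. \<Sum>q\<leftarrow>qs. ?I q x \<sigma>)"
    by (intro sum_mono disagreements_move_le) auto
  also have "\<dots> \<le> length qs * (2 * card L * s * fact (n - 2))"
    using qs
  proof (induction qs)
    case (Cons q qs)
    obtain u v where q: "q = (u, v)" by fastforce
    have uv: "u \<in> {1..n}" "v \<in> {1..n}" "u \<noteq> v" using Cons.prems q by auto
    have count: "(\<Sum>x\<in>{1..n}. \<Sum>\<sigma>\<in>?S x. of_bool (y = x \<and> \<sigma> z \<in> {\<sigma> x<..\<sigma> x + s})) \<le>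
        card L * s * fact (n - 2)" if "y \<in> {1..n}" "z \<in> {1..n}" "y \<noteq> z" for y z
    proof -
      have "(\<Sum>x\<in>{1..n}. \<Sum>\<sigma>\<in>?S x. of_bool (y = x \<and> \<sigma> z \<in> {\<sigma> x<..\<sigma> x + s})) =
          (\<Sum>x\<in>{1..n}. if x = y then (\<Sum>\<sigma>\<in>?S y. of_bool (\<sigma> z \<in> {\<sigma> y<..\<sigma> y + s}) :: nat) else 0)"
        by (intro sum.cong) auto
      also have "\<dots> = card {\<sigma>. \<sigma> permutes {1..n} \<and> \<sigma> y \<in> L \<and> \<sigma> z \<in> {\<sigma> y<..\<sigma> y + s}}"
        using that(1) fin[of y] by (simp add: Collect_conj_eq[symmetric] Int_def conj_assoc del: Collect_conj_eq)
      finally show ?thesis using card_permutes_window_le[OF that \<open>finite L\<close>, of s] by simp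
    qed
    have "(\<Sum>x\<in>{1..n}. \<Sum>\<sigma>\<in>?S x. ?I q x \<sigma>) \<le> 2 * card L * s * fact (n - 2)"
      using count[OF uv] count[OF uv(2,1) uv(3)[symmetric]] by (simp add: q sum.distrib)
    moreover have "(\<Sum>x\<in>{1..n}. \<Sum>\<sigma>\<in>?S x. \<Sum>q\<leftarrow>qs. ?I q x \<sigma>) \<le>
        length qs * (2 * card L * s * fact (n - 2))"
      using Cons.prems by (intro Cons.IH) auto
    ultimately show ?case by (simp add: sum.distrib add.assoc)
  qed simp
  finally show ?thesis .
qed

section \<open>The weighted error label by label\<close>

text \<open>Substitute \<open>i = \<sigma> x\<close>; by injectivity, the rank
  \<open>\<sigma> x\<close> lies in an image under \<open>\<sigma>\<close> exactly when the label
  \<open>x\<close> lies in the original set.\<close>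

lemma weighted_error_eq_sum_labels:
  assumes "\<sigma> permutes {1..n}"
  shows "weighted_error c n (\<sigma> ` ({1..n} \<inter> A)) (\<sigma> ` ({1..n} - A)) =
    (\<Sum>x\<in>{1..n}. of_bool (real (\<sigma> x) > real n / 2 \<and> x \<notin> A \<or> real (\<sigma> x) < real n / 2 \<and> x \<in> A) *
       \<bar>real (\<sigma> x) - real n / 2\<bar> powr c)"
proof -
  let ?A = "\<sigma> ` ({1..n} \<inter> A)" and ?R = "\<sigma> ` ({1..n} - A)"
  have "weighted_error c n ?A ?R =
    (\<Sum>i\<in>{1..n}. (of_bool (real i > real n / 2) * indicator ?R i + of_bool (real i < real n / 2) * indicator ?A i)
      * \<bar>real i - real n / 2\<bar> powr c)"
    unfolding weighted_error_def sum.inter_filter[OF finite_atLeastAtMost] sum.distrib[symmetric]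
    by (intro sum.cong) (auto simp: algebra_simps)
  also have "\<dots> = (\<Sum>x\<in>{1..n}. (of_bool (real (\<sigma> x) > real n / 2) * indicator ?R (\<sigma> x) +
      of_bool (real (\<sigma> x) < real n / 2) * indicator ?A (\<sigma> x)) * \<bar>real (\<sigma> x) - real n / 2\<bar> powr c)"
    by (subst sum.permute[OF assms]) (simp add: o_def)
  also have "\<dots> = (\<Sum>x\<in>{1..n}. of_bool (real (\<sigma> x) > real n / 2 \<and> x \<notin> A \<or> real (\<sigma> x) < real n / 2 \<and> x \<in> A) *
       \<bar>real (\<sigma> x) - real n / 2\<bar> powr c)"
    using permutes_inj[OF assms]
    by (intro sum.cong refl) (auto simp: inj_image_mem_iff indicator_def)
  finally show ?thesis .
qed

text \<open>Only mistakes in two windows of \<open>w\<close> ranks, one on each side of the median,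
  are kept. All these ranks are at distance at least \<open>w\<close> from \<open>n / 2\<close>, so
  each such mistake costs at least \<open>real w powr c\<close>.\<close>

lemma weighted_error_ge:
  fixes n w :: nat
  assumes "\<sigma> permutes {1..n}" "c \<ge> 0" "2 * w \<le> n div 2"
  shows "real w powr c * (\<Sum>x\<in>{1..n}.
      of_bool (\<sigma> x \<in> {n div 2 - 2 * w<..n div 2 - w}) * indicator A x +
      of_bool (\<sigma> x \<in> {n div 2 + w<..n div 2 + 2 * w}) * indicator (- A) x)
    \<le> weighted_error c n (\<sigma> ` ({1..n} \<inter> A)) (\<sigma> ` ({1..n} - A))"
  unfolding weighted_error_eq_sum_labels[OF assms(1)] sum_distrib_left
proof (rule sum_mono)
  fix x
  let ?e = "\<bar>real (\<sigma> x) - real n / 2\<bar>"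
  have low: "real w \<le> ?e" "real (\<sigma> x) < real n / 2" if "\<sigma> x \<in> {n div 2 - 2 * w<..n div 2 - w}"
  proof -
    \<comment> \<open>A nonempty window forces \<open>0 < w\<close>, which makes the rank strictly
      smaller than \<open>n / 2\<close>.\<close>
    have "2 * \<sigma> x + 2 * w \<le> n" "0 < w" using that by auto
    then have "2 * real (\<sigma> x) + 2 * real w \<le> real n" "0 < real w" by linarith+
    then show "real w \<le> ?e" "real (\<sigma> x) < real n / 2" by linarith+
  qed
  have high: "real w \<le> ?e" "real (\<sigma> x) > real n / 2" if "\<sigma> x \<in> {n div 2 + w<..n div 2 + 2 * w}"
  proof -
    \<comment> \<open>The excluded lower end of the window absorbs the rounding in
      \<open>n div 2\<close>: the rank is at least \<open>n div 2 + w + 1\<close>.\<close>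
    have "n + 2 * w < 2 * \<sigma> x" using that by auto
    then have "real n + 2 * real w < 2 * real (\<sigma> x)" by linarith
    then show "real w \<le> ?e" "real (\<sigma> x) > real n / 2" by linarith+
  qed
  have powr: "real w powr c \<le> ?e powr c" if "real w \<le> ?e"
    using that assms(2) by (intro powr_mono2) auto
  show "real w powr c * (of_bool (\<sigma> x \<in> {n div 2 - 2 * w<..n div 2 - w}) * indicator A x +
      of_bool (\<sigma> x \<in> {n div 2 + w<..n div 2 + 2 * w}) * indicator (- A) x) \<le>
    of_bool (real (\<sigma> x) > real n / 2 \<and> x \<notin> A \<or> real (\<sigma> x) < real n / 2 \<and> x \<in> A) * ?e powr c"
    using low high powr
    by (cases "\<sigma> x \<in> {n div 2 - 2 * w<..n div 2 - w}"; cases "\<sigma> x \<in> {n div 2 + w<..n div 2 + 2 * w}"; cases "x \<in> A")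
       (auto simp del: greaterThanAtMost_iff)
qed

section \<open>Lower bound for a deterministic algorithm\<close>

text \<open>The move depends on \<open>\<sigma>\<close>, but only through \<open>\<sigma> x\<close>,
  which can be read off from the new rank \<open>\<sigma> x + s\<close> of \<open>x\<close>; then
  the move can be undone.\<close>

lemma inj_on_move_self: "inj_on (\<lambda>\<sigma>. move (\<sigma> x) s \<circ> \<sigma>) S"
proof (rule inj_onI)
  fix \<sigma> \<tau> assume eq: "move (\<sigma> x) s \<circ> \<sigma> = move (\<tau> x) s \<circ> \<tau>"
  have "\<sigma> x = \<tau> x" using fun_cong[OF eq, of x] by (simp add: move_def)
  with eq show "\<sigma> = \<tau>" using inj_move[of "\<tau> x" s] by (auto simp: fun_eq_iff inj_def)
qed

text \<open>Each input with \<open>x\<close> in the lower window is paired with the moved input.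
  Distinct inputs have distinct partners, so the second error terms add up to at most the sum over
  all inputs with \<open>x\<close> in the upper window.\<close>

lemma testing_error_label:
  fixes orc :: "bool \<Rightarrow> 'ans::finite pmf" and n w h x :: nat
  assumes orc: "1 - \<beta> \<le> affinity UNIV (orc True) (orc False)" "\<beta> \<le> 1"
    and w: "2 * w \<le> h" "h + 2 * w \<le> n"
  defines "S \<equiv> \<lambda>I. {\<sigma>. \<sigma> permutes {1..n} \<and> \<sigma> x \<in> I}"
  shows "(\<Sum>\<sigma>\<in>S {h - 2 * w<..h - w}. 1/2 - \<beta> * real (disagreements \<sigma> (move (\<sigma> x) (3 * w) \<circ> \<sigma>) qs)) \<le>
    (\<Sum>\<sigma>\<in>S {h - 2 * w<..h - w}. measure_pmf.prob (answers orc \<sigma> qs) E) +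
    (\<Sum>\<sigma>\<in>S {h + w<..h + 2 * w}. measure_pmf.prob (answers orc \<sigma> qs) (- E))"
proof -
  let ?L = "{h - 2 * w<..h - w}" and ?H = "{h + w<..h + 2 * w}"
  have fin: "finite (S I)" for I
    unfolding S_def by (auto intro: finite_subset[OF _ finite_permutations[of "{1..n}"]])
  \<comment> \<open>A rise by \<open>3 * w\<close> carries the lower window exactly onto the upper
    one; \<open>2 * w \<le> h\<close> rules out truncated subtraction.\<close>
  have sub: "(\<lambda>\<sigma>. move (\<sigma> x) (3 * w) \<circ> \<sigma>) ` S ?L \<subseteq> S ?H"
  proof clarify
    fix \<sigma> assume "\<sigma> \<in> S ?L"
    then have \<sigma>: "\<sigma> permutes {1..n}" "\<sigma> x \<in> ?L" by (auto simp: S_def)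
    with w have "move (\<sigma> x) (3 * w) permutes {1..n}" by (intro move_permutes) auto
    then show "move (\<sigma> x) (3 * w) \<circ> \<sigma> \<in> S ?H"
      unfolding S_def using \<sigma> w by (auto intro: permutes_compose simp: move_def)
  qed
  have "(\<Sum>\<sigma>\<in>S ?L. measure_pmf.prob (answers orc (move (\<sigma> x) (3 * w) \<circ> \<sigma>) qs) (- E)) =
      (\<Sum>\<sigma>\<in>(\<lambda>\<sigma>. move (\<sigma> x) (3 * w) \<circ> \<sigma>) ` S ?L. measure_pmf.prob (answers orc \<sigma> qs) (- E))"
    by (subst sum.reindex[OF inj_on_move_self]) (simp add: comp_def)
  also have "\<dots> \<le> (\<Sum>\<sigma>\<in>S ?H. measure_pmf.prob (answers orc \<sigma> qs) (- E))"
    by (intro sum_mono2 fin sub) simp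
  finally have "(\<Sum>\<sigma>\<in>S ?L. measure_pmf.prob (answers orc (move (\<sigma> x) (3 * w) \<circ> \<sigma>) qs) (- E)) \<le> \<dots>" .
  moreover have "(\<Sum>\<sigma>\<in>S ?L. 1/2 - \<beta> * real (disagreements \<sigma> (move (\<sigma> x) (3 * w) \<circ> \<sigma>) qs)) \<le>
      (\<Sum>\<sigma>\<in>S ?L. measure_pmf.prob (answers orc \<sigma> qs) E +
        measure_pmf.prob (answers orc (move (\<sigma> x) (3 * w) \<circ> \<sigma>) qs) (- E))"
    by (intro sum_mono testing_error_answers orc)
  ultimately show ?thesis by (simp add: sum.distrib)
qed

text \<open>Double counting: under every permutation exactly \<open>card L\<close> labels have their
  rank in \<open>L\<close>.\<close>

lemma sum_permutes_hits:
  fixes n :: nat and L :: "nat set"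
  assumes "L \<subseteq> {1..n}"
  shows "(\<Sum>x\<in>{1..n}. card {\<sigma>. \<sigma> permutes {1..n} \<and> \<sigma> x \<in> L}) = fact n * card L"
proof -
  let ?P = "{\<sigma>. \<sigma> permutes {1..n}}"
  have fin: "finite ?P" by (simp add: finite_permutations)
  have "(\<Sum>x\<in>{1..n}. card {\<sigma>. \<sigma> permutes {1..n} \<and> \<sigma> x \<in> L}) = (\<Sum>x\<in>{1..n}. \<Sum>\<sigma>\<in>?P. of_bool (\<sigma> x \<in> L))"
    using fin by (simp add: Int_def)
  also have "\<dots> = (\<Sum>\<sigma>\<in>?P. \<Sum>x\<in>{1..n}. of_bool (\<sigma> x \<in> L))"
    by (rule sum.swap)
  also have "\<dots> = (\<Sum>\<sigma>\<in>?P. card L)"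
  proof (rule sum.cong)
    fix \<sigma> assume "\<sigma> \<in> ?P"
    then have "(\<Sum>x\<in>{1..n}. of_bool (\<sigma> x \<in> L) :: nat) = (\<Sum>i\<in>{1..n}. of_bool (i \<in> L))"
      using sum.permute[of \<sigma> "{1..n}" "\<lambda>i. of_bool (i \<in> L) :: nat"] by (simp add: o_def)
    also have "\<dots> = card ({1..n} \<inter> L)" by simp
    finally show "(\<Sum>x\<in>{1..n}. of_bool (\<sigma> x \<in> L)) = card L"
      using assms by (simp add: Int_absorb1)
  qed simp
  also have "\<dots> = fact n * card L" by (simp add: card_permutations)
  finally show ?thesis .
qed

text \<open>Summed over all labels and averaged over all inputs, the constant \<open>1/2\<close> of
  the testing bound gives \<open>w / 2\<close>, since \<open>w\<close> labels lie in the lower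
  window of each input. The subtracted term is the expected number of changed answers times
  \<open>\<beta>\<close>, where 6 comes from \<open>2 * w * (3 * w)\<close>.\<close>

lemma deterministic_error_ge:
  fixes orc :: "bool \<Rightarrow> 'ans::finite pmf" and n w :: nat
  assumes orc: "1 - \<beta> \<le> affinity UNIV (orc True) (orc False)" and \<beta>: "0 \<le> \<beta>" "\<beta> \<le> 1"
    and w: "2 * w \<le> n div 2" and c: "0 \<le> c" and n: "2 \<le> n"
    and qs: "\<forall>(u, v)\<in>set qs. u \<in> {1..n} \<and> v \<in> {1..n} \<and> u \<noteq> v"
  shows "real w powr c * (real w / 2 - 6 * \<beta> * real (length qs) * (real w)\<^sup>2 / (real n * (real n - 1)))
    \<le> (\<Sum>\<sigma> | \<sigma> permutes {1..n}. measure_pmf.expectation (answers orc \<sigma> qs)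
        (\<lambda>as. weighted_error c n (\<sigma> ` ({1..n} \<inter> acc as)) (\<sigma> ` ({1..n} - acc as)))) / fact n"
proof -
  let ?h = "n div 2"
  let ?L = "{?h - 2 * w<..?h - w}" and ?H = "{?h + w<..?h + 2 * w}"
  let ?P = "{\<sigma>. \<sigma> permutes {1..n}}"
  let ?S = "\<lambda>x I. {\<sigma>. \<sigma> permutes {1..n} \<and> \<sigma> x \<in> I}"
  let ?E = "\<lambda>x. {as. x \<in> acc as}"
  let ?D = "\<lambda>x \<sigma>. disagreements \<sigma> (move (\<sigma> x) (3 * w) \<circ> \<sigma>) qs"
  let ?p = "\<lambda>\<sigma>. measure_pmf.prob (answers orc \<sigma> qs)"
  have fin: "finite ?P" by (simp add: finite_permutations)
  have int: "integrable (measure_pmf (answers orc \<sigma> qs)) f" for \<sigma> and f :: "_ \<Rightarrow> real"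
    by (rule integrable_measure_pmf_finite[OF finite_set_pmf_answers])
  have L: "?L \<subseteq> {1..n}" "card ?L = w" using w by auto
  have "(\<Sum>x\<in>{1..n}. \<Sum>\<sigma>\<in>?S x ?L. ?D x \<sigma>) \<le> length qs * (2 * w * (3 * w) * fact (n - 2))"
    using sum_disagreements_move_le[OF _ qs, of ?L "3 * w"] L(2) by simp
  then have "real (\<Sum>x\<in>{1..n}. \<Sum>\<sigma>\<in>?S x ?L. ?D x \<sigma>) \<le> real (length qs * (2 * w * (3 * w) * fact (n - 2)))"
    by (simp only: of_nat_le_iff)
  then have D: "\<beta> * (\<Sum>x\<in>{1..n}. \<Sum>\<sigma>\<in>?S x ?L. real (?D x \<sigma>)) \<le>
      \<beta> * (real (length qs) * (6 * (real w)\<^sup>2 * fact (n - 2)))"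
    using \<beta> by (intro mult_left_mono) (simp_all add: power2_eq_square mult.assoc)
  have "fact n = real n * (real n - 1) * fact (n - 2)"
    using n fact_reduce[of n, where 'a = real] fact_reduce[of "n - 1", where 'a = real]
    by (simp add: numeral_2_eq_2 of_nat_diff)
  then have fact: "fact (n - 2) / fact n = 1 / (real n * (real n - 1))"
    using n by (simp add: field_simps)
  have hits: "real (\<Sum>x\<in>{1..n}. card (?S x ?L)) = fact n * real w"
    unfolding sum_permutes_hits[OF L(1)] L(2) by simp
  have "fact n * real w / 2 - \<beta> * (real (length qs) * (6 * (real w)\<^sup>2 * fact (n - 2))) \<le>
      (\<Sum>x\<in>{1..n}. \<Sum>\<sigma>\<in>?S x ?L. 1/2 - \<beta> * real (?D x \<sigma>))"
    using D hits by (simp add: sum_subtractf sum_distrib_left flip: sum_divide_distrib)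
  also have "\<dots> \<le> (\<Sum>x\<in>{1..n}. (\<Sum>\<sigma>\<in>?S x ?L. ?p \<sigma> (?E x)) + (\<Sum>\<sigma>\<in>?S x ?H. ?p \<sigma> (- ?E x)))"
    using w by (intro sum_mono testing_error_label orc \<beta>) auto
  also have "\<dots> = (\<Sum>x\<in>{1..n}. \<Sum>\<sigma>\<in>?P. of_bool (\<sigma> x \<in> ?L) * ?p \<sigma> (?E x) + of_bool (\<sigma> x \<in> ?H) * ?p \<sigma> (- ?E x))"
    using fin by (simp add: sum.distrib Int_def sum.inter_filter[symmetric] of_bool_def if_distrib[of "\<lambda>t. t * _"] cong: if_cong del: greaterThanAtMost_iff)
  also have "\<dots> = (\<Sum>\<sigma>\<in>?P. \<Sum>x\<in>{1..n}. of_bool (\<sigma> x \<in> ?L) * ?p \<sigma> (?E x) + of_bool (\<sigma> x \<in> ?H) * ?p \<sigma> (- ?E x))"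
    by (rule sum.swap)
  finally have count: "fact n * real w / 2 - \<beta> * (real (length qs) * (6 * (real w)\<^sup>2 * fact (n - 2))) \<le> \<dots>" .
  have "real w powr c * (\<Sum>\<sigma>\<in>?P. \<Sum>x\<in>{1..n}. of_bool (\<sigma> x \<in> ?L) * ?p \<sigma> (?E x) + of_bool (\<sigma> x \<in> ?H) * ?p \<sigma> (- ?E x)) \<le>
     (\<Sum>\<sigma> | \<sigma> permutes {1..n}. measure_pmf.expectation (answers orc \<sigma> qs)
        (\<lambda>as. weighted_error c n (\<sigma> ` ({1..n} \<inter> acc as)) (\<sigma> ` ({1..n} - acc as))))"
    unfolding sum_distrib_left[of _ _ ?P]
  proof (rule sum_mono)
    fix \<sigma> assume \<sigma>: "\<sigma> \<in> ?P"
    \<comment> \<open>Linearity of expectation turns the probabilities back into indicators, so that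
      the pointwise bound on the weighted error applies to each answer list.\<close>
    have "real w powr c * (\<Sum>x\<in>{1..n}. of_bool (\<sigma> x \<in> ?L) * ?p \<sigma> (?E x) + of_bool (\<sigma> x \<in> ?H) * ?p \<sigma> (- ?E x)) =
      measure_pmf.expectation (answers orc \<sigma> qs) (\<lambda>as. real w powr c * (\<Sum>x\<in>{1..n}.
        of_bool (\<sigma> x \<in> ?L) * indicator (?E x) as + of_bool (\<sigma> x \<in> ?H) * indicator (- ?E x) as))"
      by (simp add: int Bochner_Integration.integral_sum Bochner_Integration.integral_add)
    also have "\<dots> \<le> measure_pmf.expectation (answers orc \<sigma> qs)
        (\<lambda>as. weighted_error c n (\<sigma> ` ({1..n} \<inter> acc as)) (\<sigma> ` ({1..n} - acc as)))"
    proof (rule integral_mono[OF int int])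
      fix as
      show "real w powr c * (\<Sum>x\<in>{1..n}. of_bool (\<sigma> x \<in> ?L) * indicator (?E x) as + of_bool (\<sigma> x \<in> ?H) * indicator (- ?E x) as)
        \<le> weighted_error c n (\<sigma> ` ({1..n} \<inter> acc as)) (\<sigma> ` ({1..n} - acc as))"
        using weighted_error_ge[of \<sigma> n c w "acc as"] \<sigma> c w by (simp add: indicator_def)
    qed
    finally show "real w powr c * (\<Sum>x\<in>{1..n}. of_bool (\<sigma> x \<in> ?L) * ?p \<sigma> (?E x) + of_bool (\<sigma> x \<in> ?H) * ?p \<sigma> (- ?E x)) \<le> \<dots>" .
  qed
  then have "real w powr c * (fact n * real w / 2 - \<beta> * (real (length qs) * (6 * (real w)\<^sup>2 * fact (n - 2)))) / fact n \<le>
     (\<Sum>\<sigma> | \<sigma> permutes {1..n}. measure_pmf.expectation (answers orc \<sigma> qs)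
        (\<lambda>as. weighted_error c n (\<sigma> ` ({1..n} \<inter> acc as)) (\<sigma> ` ({1..n} - acc as)))) / fact n"
    using mult_left_mono[OF count, of "real w powr c"] by (intro divide_right_mono) auto
  moreover have "real w powr c * (fact n * real w / 2 - \<beta> * (real (length qs) * (6 * (real w)\<^sup>2 * fact (n - 2)))) / fact n =
      real w powr c * (real w / 2 - 6 * \<beta> * real (length qs) * (real w)\<^sup>2 * (fact (n - 2) / fact n))"
    by (simp add: diff_divide_distrib right_diff_distrib)
  ultimately show ?thesis unfolding fact by simp
qed

section \<open>From deterministic to randomized algorithms\<close>

text \<open>The support of \<open>M\<close> may be infinite. The nonnegative integral of a bind is
  an iterated integral without integrability conditions, and the finite range of \<open>f\<close>
  gives the integrability for translating back to expectations.\<close>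

lemma expectation_bind_ge:
  fixes f :: "'b \<Rightarrow> real"
  assumes nonneg: "\<And>x. 0 \<le> f x" and fin: "finite (f ` set_pmf (M \<bind> N))"
    and ge: "\<And>s. s \<in> set_pmf M \<Longrightarrow> a \<le> measure_pmf.expectation (N s) f"
  shows "a \<le> measure_pmf.expectation (M \<bind> N) f"
proof -
  have bdd: "integrable (measure_pmf K) f" if "set_pmf K \<subseteq> set_pmf (M \<bind> N)" for K
  proof (rule measure_pmf.integrable_const_bound)
    show "AE x in measure_pmf K. norm (f x) \<le> Max (f ` set_pmf (M \<bind> N))"
      using nonneg that fin by (auto simp: AE_measure_pmf_iff intro!: Max_ge)
  qed simp
  have "ennreal a \<le> (\<integral>\<^sup>+s. \<integral>\<^sup>+x. f x \<partial>N s \<partial>M)"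
  proof (rule measure_pmf.nn_integral_ge_const, simp only: AE_measure_pmf_iff, intro ballI)
    fix s assume s: "s \<in> set_pmf M"
    have "(\<integral>\<^sup>+x. f x \<partial>N s) = ennreal (measure_pmf.expectation (N s) f)"
      using s nonneg by (intro nn_integral_eq_integral bdd) auto
    then show "ennreal a \<le> (\<integral>\<^sup>+x. f x \<partial>N s)" using ge[OF s] by (simp add: ennreal_leI)
  qed
  also have "\<dots> = (\<integral>\<^sup>+x. f x \<partial>bind_pmf M N)" by simp
  also have "\<dots> = ennreal (measure_pmf.expectation (M \<bind> N) f)"
    using nonneg by (intro nn_integral_eq_integral bdd) auto
  finally show ?thesis using nonneg by (simp add: ennreal_le_iff integral_nonneg)
qed

lemma weighted_error_nonneg: "0 \<le> weighted_error c n A R"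
  unfolding weighted_error_def by (intro add_nonneg_nonneg sum_nonneg) auto

text \<open>The easy direction of Yao's principle: a bound for every deterministic algorithm on a
  uniformly random input carries over to mixtures.\<close>

lemma expected_error_ge:
  fixes orc :: "bool \<Rightarrow> 'ans::finite pmf"
  assumes "\<And>s. s \<in> set_pmf alg \<Longrightarrow> a \<le>
    (\<Sum>\<sigma> | \<sigma> permutes {1..n}. measure_pmf.expectation (answers orc \<sigma> (queries s))
        (\<lambda>as. weighted_error c n (\<sigma> ` ({1..n} \<inter> accept s as)) (\<sigma> ` ({1..n} - accept s as)))) / fact n"
  shows "a \<le> expected_error orc c n alg"
proof -
  let ?P = "{\<sigma>. \<sigma> permutes {1..n}}"
  let ?W = "\<lambda>(\<sigma>, s :: 'ans nonadaptive, as). weighted_error c n (\<sigma> ` ({1..n} \<inter> accept s as)) (\<sigma> ` ({1..n} - accept s as))"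
  define N where "N (s :: 'ans nonadaptive) = pmf_of_set ?P \<bind> (\<lambda>\<sigma>. map_pmf (\<lambda>as. (\<sigma>, s, as)) (answers orc \<sigma> (queries s)))" for s
  have P: "finite ?P" "?P \<noteq> {}" "card ?P = fact n"
    by (auto simp: finite_permutations card_permutations intro: permutes_id)
  \<comment> \<open>Input and algorithm are independent, so the algorithm can be drawn first and the
    bound applied given \<open>s\<close>.\<close>
  have "error_distribution orc c n alg = map_pmf ?W (alg \<bind> N)"
    unfolding error_distribution_def N_def
    by (subst bind_commute_pmf) (simp add: map_bind_pmf map_pmf_def[symmetric] pmf.map_comp o_def)
  then have "expected_error orc c n alg = measure_pmf.expectation (alg \<bind> N) ?W"
    unfolding expected_error_def by simp
  also have "a \<le> \<dots>"
  proof (rule expectation_bind_ge)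
    \<comment> \<open>The error depends only on two subsets of \<open>{1..n}\<close>, so it takes
      finitely many values even when \<open>alg\<close> has infinite support.\<close>
    have "?W ` set_pmf (alg \<bind> N) \<subseteq> (\<lambda>(A, R). weighted_error c n A R) ` (Pow {1..n} \<times> Pow {1..n})"
    proof clarify
      fix \<sigma> s as assume "(\<sigma>, s, as) \<in> set_pmf (alg \<bind> N)"
      then have "\<sigma> permutes {1..n}" using P by (auto simp: N_def)
      then have "\<sigma> ` {1..n} = {1..n}" by (rule permutes_image)
      then show "weighted_error c n (\<sigma> ` ({1..n} \<inter> accept s as)) (\<sigma> ` ({1..n} - accept s as)) \<in>
        (\<lambda>(A, R). weighted_error c n A R) ` (Pow {1..n} \<times> Pow {1..n})"
        by (intro image_eqI[of _ _ "(\<sigma> ` ({1..n} \<inter> accept s as), \<sigma> ` ({1..n} - accept s as))"]) auto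
    qed
    then show "finite (?W ` set_pmf (alg \<bind> N))" by (rule finite_subset) auto
    fix s assume "s \<in> set_pmf alg"
    from assms[OF this] show "a \<le> measure_pmf.expectation (N s) ?W"
      unfolding N_def using P
      by (subst pmf_expectation_bind_pmf_of_set)
         (auto simp: finite_set_pmf_answers sum_distrib_left sum_divide_distrib divide_inverse mult.commute)
  qed (auto simp: weighted_error_nonneg)
  finally show ?thesis .
qed

section \<open>Choice of the window width and the three models\<close>

text \<open>The width \<open>w\<close> is \<open>\<epsilon> * n / (d * \<beta>)\<close> rounded
  down. The bound \<open>\<delta> / 8\<close> on \<open>\<epsilon>\<close> makes the windows fit
  into \<open>{1..n}\<close>, and \<open>1 / 48\<close> keeps the loss from changed answers below
  half of the main term \<open>w / 2\<close>.\<close>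

lemma expected_error_ge_of_affinity:
  fixes orc :: "bool \<Rightarrow> 'ans::finite pmf" and c \<delta> \<beta> d :: real and n :: nat
  defines "\<epsilon> \<equiv> min (\<delta> / 8) (1 / 48)"
  assumes c: "0 \<le> c" and \<delta>: "0 < \<delta>"
    and orc: "1 - \<beta> \<le> affinity UNIV (orc True) (orc False)" and \<beta>: "0 < \<beta>" "\<beta> \<le> 1"
    and d: "0 < d" "\<delta> \<le> d * \<beta>" and large: "1 / \<epsilon> \<le> real n / (d * \<beta>)"
    and alg: "nonadaptive_algorithm n (d * real n) alg"
  shows "(\<epsilon> / 2) powr (c + 1) / 4 * (real n / (d * \<beta>)) powr (c + 1) \<le> expected_error orc c n alg"
proof (rule expected_error_ge)
  fix s assume s: "s \<in> set_pmf alg"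
  have len: "real (length (queries s)) \<le> d * real n"
    and qs: "\<forall>(u, v)\<in>set (queries s). u \<in> {1..n} \<and> v \<in> {1..n} \<and> u \<noteq> v"
    using alg s unfolding nonadaptive_algorithm_def by auto
  define m where "m = real n / (d * \<beta>)"
  define w where "w = nat \<lfloor>\<epsilon> * m\<rfloor>"
  have \<epsilon>: "0 < \<epsilon>" "\<epsilon> \<le> \<delta> / 8" "\<epsilon> \<le> 1 / 48" using \<delta> by (auto simp: \<epsilon>_def)
  have db: "0 < d * \<beta>" using \<beta> d by simp
  have m: "1 \<le> \<epsilon> * m" using large \<epsilon>(1) by (simp add: m_def pos_divide_le_eq mult.commute)
  have mpos: "0 < m" using m \<epsilon>(1) by (metis less_le_trans zero_less_mult_pos zero_less_one)
  have nm: "real n = m * (d * \<beta>)" using \<beta> d by (simp add: m_def)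
  \<comment> \<open>A real number that is at least 1 loses at most half of its value when rounded
    down.\<close>
  have wle: "real w \<le> \<epsilon> * m" and w1: "1 \<le> w" and wge: "\<epsilon> * m / 2 \<le> real w"
  proof -
    have "real w = of_int \<lfloor>\<epsilon> * m\<rfloor>" "1 \<le> \<lfloor>\<epsilon> * m\<rfloor>"
      using m by (auto simp: w_def le_floor_iff)
    then show "real w \<le> \<epsilon> * m" "1 \<le> w" "\<epsilon> * m / 2 \<le> real w"
      using real_of_int_floor_add_one_gt[of "\<epsilon> * m"] by linarith+
  qed
  have "real w \<le> \<delta> / 8 * m" using wle mult_right_mono[OF \<epsilon>(2), of m] mpos by linarith
  also have "\<dots> \<le> real n / 8" using mult_left_mono[OF d(2), of m] mpos by (simp add: nm mult.commute)
  finally have w8: "8 * w \<le> n" by linarith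
  then have n: "8 \<le> n" and w2: "2 * w \<le> n div 2" using w1 by linarith+
  have "\<beta> * real (length (queries s)) * real w \<le> \<beta> * (d * real n) * (\<epsilon> * m)"
    using len wle \<beta> by (intro mult_mono) auto
  also have "\<dots> = \<epsilon> * (real n * real n)" using nm by (simp add: algebra_simps)
  \<comment> \<open>Here \<open>n \<le> 2 * (n - 1)\<close> costs a factor 2, leaving
    \<open>1 / 24\<close> after division; multiplied by \<open>6 * w\<close> this is the loss
    \<open>w / 4\<close>.\<close>
  also have "\<dots> \<le> 1 / 48 * (real n * (2 * (real n - 1)))"
    using \<epsilon> n by (intro mult_mono) auto
  finally have "\<beta> * real (length (queries s)) * real w / (real n * (real n - 1)) \<le> 1 / 24"
    using n by (simp add: divide_simps) (simp add: algebra_simps)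
  then have "6 * real w * (\<beta> * real (length (queries s)) * real w / (real n * (real n - 1))) \<le> 6 * real w * (1 / 24)"
    by (intro mult_left_mono) auto
  then have loss: "real w / 4 \<le> real w / 2 -
      6 * \<beta> * real (length (queries s)) * (real w)\<^sup>2 / (real n * (real n - 1))"
    by (simp add: power2_eq_square ac_simps)
  have "(\<epsilon> / 2) powr (c + 1) / 4 * m powr (c + 1) = (\<epsilon> * m / 2) powr (c + 1) / 4"
    using \<epsilon> mpos by (simp add: powr_mult[symmetric])
  also have "\<dots> \<le> real w powr (c + 1) / 4"
    using wge c \<epsilon> mpos by (intro divide_right_mono powr_mono2) auto
  also have "\<dots> = real w powr c * (real w / 4)" using w1 by (simp add: powr_add)
  also have "\<dots> \<le> real w powr c * (real w / 2 -
      6 * \<beta> * real (length (queries s)) * (real w)\<^sup>2 / (real n * (real n - 1)))"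
    using loss by (intro mult_left_mono) auto
  also have "\<dots> \<le> (\<Sum>\<sigma> | \<sigma> permutes {1..n}. measure_pmf.expectation (answers orc \<sigma> (queries s))
        (\<lambda>as. weighted_error c n (\<sigma> ` ({1..n} \<inter> accept s as)) (\<sigma> ` ({1..n} - accept s as)))) / fact n"
    using \<beta> n by (intro deterministic_error_ge orc w2 c qs) auto
  finally show "(\<epsilon> / 2) powr (c + 1) / 4 * (real n / (d * \<beta>)) powr (c + 1) \<le> \<dots>" unfolding m_def .
qed

text \<open>The constants \<open>C\<close> and \<open>K\<close> depend only on \<open>c\<close> and
  \<open>\<delta>\<close>. For fixed \<open>n\<close> the error is bounded, so no constant is
  uniform as \<open>d\<close>, \<open>d * \<gamma>\<close> or \<open>d * \<gamma>\<^sup>2\<close>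
  tends to 0, hence \<open>\<delta>\<close>. When \<open>n / d\<close> is small, noiseless queries
  can compare all pairs and leave no error, hence \<open>K\<close>.\<close>

theorem theorem4:
  fixes c \<delta> :: real
  assumes "c \<ge> 0" and "\<delta> > 0"
  shows "\<exists>C>0. \<exists>K>0.
    (\<forall>(n::nat) (d::real) (alg :: bool nonadaptive pmf).
       d > 0 \<longrightarrow> \<delta> \<le> d \<longrightarrow> K \<le> real n / d \<longrightarrow>
       nonadaptive_algorithm n (d * real n) alg \<longrightarrow>
       expected_error noiseless c n alg \<ge> C * (real n / d) powr (c + 1)) \<and>
    (\<forall>(n::nat) (d::real) (\<gamma>::real) (alg :: bool option nonadaptive pmf).
       d > 0 \<longrightarrow> 0 < \<gamma> \<longrightarrow> \<gamma> \<le> 1 \<longrightarrow> \<delta> \<le> d * \<gamma> \<longrightarrow> K \<le> real n / (d * \<gamma>) \<longrightarrow>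
       nonadaptive_algorithm n (d * real n) alg \<longrightarrow>
       expected_error (erasure \<gamma>) c n alg \<ge> C * (real n / (d * \<gamma>)) powr (c + 1)) \<and>
    (\<forall>(n::nat) (d::real) (\<gamma>::real) (alg :: bool nonadaptive pmf).
       d > 0 \<longrightarrow> 0 < \<gamma> \<longrightarrow> \<gamma> \<le> 1 \<longrightarrow> \<delta> \<le> d * \<gamma>\<^sup>2 \<longrightarrow> K \<le> real n / (d * \<gamma>\<^sup>2) \<longrightarrow>
       nonadaptive_algorithm n (d * real n) alg \<longrightarrow>
       expected_error (noisy \<gamma>) c n alg \<ge> C * (real n / (d * \<gamma>\<^sup>2)) powr (c + 1))"
proof -
  define \<epsilon> where "\<epsilon> = min (\<delta> / 8) (1 / 48)"
  define C where "C = (\<epsilon> / 2) powr (c + 1) / 4"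
  have \<epsilon>: "0 < \<epsilon>" using assms by (simp add: \<epsilon>_def)
  \<comment> \<open>The same constants serve all three models, which differ only in
    \<open>\<beta>\<close>: it is 1, \<open>\<gamma>\<close> and
    \<open>\<gamma>\<^sup>2\<close>.\<close>
  note bound = expected_error_ge_of_affinity[OF assms, folded \<epsilon>_def, folded C_def]
  show ?thesis
  proof (rule exI[of _ C], intro exI[of _ "1 / \<epsilon>"] conjI allI impI)
    fix n :: nat and d :: real and alg :: "bool nonadaptive pmf"
    assume "d > 0" "\<delta> \<le> d" "1 / \<epsilon> \<le> real n / d" "nonadaptive_algorithm n (d * real n) alg"
    then show "expected_error noiseless c n alg \<ge> C * (real n / d) powr (c + 1)"
      using bound[of 1 noiseless d n alg] by (simp add: affinity_noiseless)
  next
    fix n :: nat and d \<gamma> :: real and alg :: "bool option nonadaptive pmf"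
    assume "d > 0" "0 < \<gamma>" "\<gamma> \<le> 1" "\<delta> \<le> d * \<gamma>" "1 / \<epsilon> \<le> real n / (d * \<gamma>)"
      "nonadaptive_algorithm n (d * real n) alg"
    then show "expected_error (erasure \<gamma>) c n alg \<ge> C * (real n / (d * \<gamma>)) powr (c + 1)"
      by (intro bound) (simp_all add: affinity_erasure)
  next
    fix n :: nat and d \<gamma> :: real and alg :: "bool nonadaptive pmf"
    assume "d > 0" "0 < \<gamma>" "\<gamma> \<le> 1" "\<delta> \<le> d * \<gamma>\<^sup>2" "1 / \<epsilon> \<le> real n / (d * \<gamma>\<^sup>2)"
      "nonadaptive_algorithm n (d * real n) alg"
    then show "expected_error (noisy \<gamma>) c n alg \<ge> C * (real n / (d * \<gamma>\<^sup>2)) powr (c + 1)"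
      by (intro bound) (simp_all add: affinity_noisy power_le_one)
  qed (use \<epsilon> in \<open>simp_all add: C_def\<close>)
qed

end
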